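(* The Frank number of the Petersen graph is $3$.
   Context: An orientation of a graph $G$ replaces each edge $uv$ by exactly one of the arcs $uv$ or $vu$; for an edge $e$, $\vec e$ denotes the corresponding arc. A digraph is strongly connected if for every nonempty proper vertex subset $X$ some arc leaves $X$. For a $3$-edge-connected graph $G$, the Frank number $f(G)$ is the minimum integer $k$ such that there exist $k$ orientations $D_1,\dots,D_k$ of $G$ with the property that for every edge $e$ of $G$ there is an $i$ with $D_i-\vec e$ strongly connected. *)

theory Defs
  imports "Graph_Theory.Graph_Theory"
begin

text \<open>Undirected graphs; parallel edges are allowed, since edges are named and
  \<open>uends e\<close> is the set of the two endvertices of \<open>e\<close>.\<close>

record ('v, 'e) ugraph =
  uverts :: "'v set"
  uedges :: "'e set"
  uends :: "'e \<Rightarrow> 'v set"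

definition wf_ugraph :: "('v, 'e) ugraph \<Rightarrow> bool" where
  "wf_ugraph G \<longleftrightarrow> finite (uverts G) \<and> uverts G \<noteq> {} \<and> finite (uedges G) \<and>
     (\<forall>e\<in>uedges G. uends G e \<subseteq> uverts G \<and> card (uends G e) = 2)"

definition edge_cut :: "('v, 'e) ugraph \<Rightarrow> 'v set \<Rightarrow> 'e set" where
  "edge_cut G X = {e \<in> uedges G. uends G e \<inter> X \<noteq> {} \<and> uends G e \<inter> (uverts G - X) \<noteq> {}}"

definition edge_connected :: "nat \<Rightarrow> ('v, 'e) ugraph \<Rightarrow> bool" where
  "edge_connected k G \<longleftrightarrow>
     (\<forall>X. X \<noteq> {} \<longrightarrow> X \<subset> uverts G \<longrightarrow> k \<le> card (edge_cut G X))"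

text \<open>An orientation keeps the names of the edges, so the arc corresponding to the edge \<open>e\<close>
  of the graph is again called \<open>e\<close>; only its tail and head are chosen.\<close>

definition orientation_of :: "('v, 'e) pre_digraph \<Rightarrow> ('v, 'e) ugraph \<Rightarrow> bool" where
  "orientation_of D G \<longleftrightarrow> verts D = uverts G \<and> arcs D = uedges G \<and>
     (\<forall>e\<in>uedges G. {tail D e, head D e} = uends G e)"

text \<open>Strong connectivity via leaving arcs. The lemma \<open>strong_iff_strongly_connected\<close> below
  relates it to the reachability-based library notion.\<close>

definition strong :: "('v, 'e) pre_digraph \<Rightarrow> bool" where
  "strong D \<longleftrightarrow>
     (\<forall>X. X \<noteq> {} \<longrightarrow> X \<subset> verts D \<longrightarrow> (\<exists>a\<in>arcs D. tail D a \<in> X \<and> head D a \<in> verts D - X))"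

definition frank_orientations :: "('v, 'e) ugraph \<Rightarrow> nat \<Rightarrow> (nat \<Rightarrow> ('v, 'e) pre_digraph) \<Rightarrow> bool" where
  "frank_orientations G k D \<longleftrightarrow>
     (\<forall>i\<in>{1..k}. orientation_of (D i) G) \<and>
     (\<forall>e\<in>uedges G. \<exists>i\<in>{1..k}. strong (pre_digraph.del_arc (D i) e))"

text \<open>Meaningful only for 3-edge-connected graphs: otherwise no \<open>k\<close> need exist, and then the
  value is unspecified. See \<open>edge_connected_petersen\<close> below.\<close>

definition frank_number :: "('v, 'e) ugraph \<Rightarrow> nat" where
  "frank_number G = (LEAST k. \<exists>D. frank_orientations G k D)"

text \<open>The usual drawing: an outer 5-cycle on \<open>0, \<dots>, 4\<close>, spokes from \<open>i\<close> to \<open>i + 5\<close>, and an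
  inner pentagram on \<open>5, \<dots>, 9\<close>.\<close>

definition petersen :: "(nat, nat set) ugraph" where
  "petersen = \<lparr>uverts = {..<10},
     uedges = {{i, (i + 1) mod 5} | i. i < 5} \<union> {{i, i + 5} | i. i < 5} \<union>
              {{i + 5, (i + 2) mod 5 + 5} | i. i < 5},
     uends = (\<lambda>e. e)\<rparr>"

lemma strong_iff_strongly_connected:
  assumes "wf_digraph D" "verts D \<noteq> {}"
  shows "strong D \<longleftrightarrow> strongly_connected D"
proof
  interpret wf_digraph D by fact
  assume st: "strong D"
  have "u \<rightarrow>\<^sup>*\<^bsub>D\<^esub> v" if u: "u \<in> verts D" and v: "v \<in> verts D" for u v
  proof (rule ccontr)
    assume nr: "\<not> u \<rightarrow>\<^sup>*\<^bsub>D\<^esub> v"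
    let ?X = "{w \<in> verts D. u \<rightarrow>\<^sup>*\<^bsub>D\<^esub> w}"
    have "?X \<noteq> {}" "?X \<subset> verts D" using u v nr by auto
    then obtain a where a: "a \<in> arcs D" "tail D a \<in> ?X" "head D a \<in> verts D - ?X"
      using st unfolding strong_def by meson
    then have "u \<rightarrow>\<^sup>*\<^bsub>D\<^esub> head D a"
      by (blast intro: reachable_adj_trans in_arcs_imp_in_arcs_ends)
    with a show False by auto
  qed
  then show "strongly_connected D" using assms(2) unfolding strongly_connected_def by auto
next
  interpret wf_digraph D by fact
  assume sc: "strongly_connected D"
  show "strong D" unfolding strong_def
  proof (intro allI impI)
    fix X assume X: "X \<noteq> {}" "X \<subset> verts D"
    then obtain u v where uv: "u \<in> X" "v \<in> verts D" "v \<notin> X" by auto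
    then have "u \<rightarrow>\<^sup>*\<^bsub>D\<^esub> v" using sc X unfolding strongly_connected_def by blast
    then have "v \<notin> X \<longrightarrow> (\<exists>a\<in>arcs D. tail D a \<in> X \<and> head D a \<in> verts D - X)"
    proof (induct rule: reachable_induct)
      case base then show ?case using uv by auto
    next
      case (step x y)
      then show ?case by (cases "x \<in> X") (auto simp: arcs_ends_conv)
    qed
    then show "\<exists>a\<in>arcs D. tail D a \<in> X \<and> head D a \<in> verts D - X" using uv by simp
  qed
qed

definition petersen_pairs :: "(nat \<times> nat) list" where
  "petersen_pairs = [(0,1),(1,2),(2,3),(3,4),(4,0),(0,5),(1,6),(2,7),(3,8),(4,9),
     (5,7),(6,8),(7,9),(8,5),(9,6)]"

lemma uedges_petersen: "uedges petersen = (\<lambda>(u, v). {u, v}) ` set petersen_pairs"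
proof -
  have set5: "{f i | i. i < (5::nat)} = f ` {0, 1, 2, 3, 4}" for f :: "nat \<Rightarrow> nat set"
  proof -
    have "{..<5::nat} = {0, 1, 2, 3, 4}" by auto
    then show ?thesis by (auto simp: image_iff set_eq_iff lessThan_def)
  qed
  show ?thesis unfolding petersen_def petersen_pairs_def ugraph.simps set5
    by (simp add: insert_commute numeral_2_eq_2[symmetric])
qed

lemma wf_ugraph_petersen: "wf_ugraph petersen"
proof -
  have "uverts petersen = {..<10}" "uends petersen = (\<lambda>e. e)" by (simp_all add: petersen_def)
  then show ?thesis
    by (auto simp: wf_ugraph_def uedges_petersen petersen_pairs_def lessThan_empty_iff)
qed

lemma petersen_cuts:
  assumes "\<not> ((\<forall>x<10. p x) \<or> (\<forall>x<10. \<not> p x))"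
  shows "3 \<le> length (filter (\<lambda>(u, v). p u \<noteq> p v) petersen_pairs)"
  using assms unfolding petersen_pairs_def
  apply (simp add: numeral_eq_Suc All_less_Suc)
  apply (smt (verit) length_Cons)
  done

lemma edge_connected_petersen: "edge_connected 3 petersen"
  unfolding edge_connected_def
proof (intro allI impI)
  fix X assume X: "X \<noteq> {}" "X \<subset> uverts petersen"
  have V: "uverts petersen = {0..<10}" by (auto simp: petersen_def)
  let ?P = "\<lambda>(u, v). (u \<in> X) \<noteq> (v \<in> X)"
  let ?f = "\<lambda>(u, v). {u, v::nat}"
  have "\<not> ((\<forall>x<10. x \<in> X) \<or> (\<forall>x<10. x \<notin> X))"
    using X unfolding V psubset_eq by (metis atLeastLessThan_iff subset_eq all_not_in_conv subset_antisym)
  then have "3 \<le> length (filter ?P petersen_pairs)"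
    by (rule petersen_cuts)
  also have "\<dots> = card (set (filter ?P petersen_pairs))"
    by (rule distinct_card[symmetric], rule distinct_filter) (simp add: petersen_pairs_def)
  also have "\<dots> = card (?f ` set (filter ?P petersen_pairs))"
  proof (rule card_image[symmetric], rule inj_on_subset)
    show "inj_on ?f (set petersen_pairs)"
      unfolding petersen_pairs_def by (simp add: doubleton_eq_iff)
  qed auto
  also have "?f ` set (filter ?P petersen_pairs) = edge_cut petersen X"
  proof -
    have vs: "set petersen_pairs \<subseteq> {0..<10} \<times> {0..<10}" by (simp add: petersen_pairs_def)
    have e: "uends petersen = (\<lambda>e. e)" by (simp add: petersen_def)
    show ?thesis unfolding edge_cut_def uedges_petersen e V using vs by fastforce
  qed
  finally show "3 \<le> card (edge_cut petersen X)" .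
qed

end

theory Submission
  imports Defs
begin

text \<open>Upper bound: three orientations suffice, and the strong connectivity of their arc-deleted
  subdigraphs is witnessed by four closed walks through all vertices such that every edge is missed
  by at least one of them.
  Lower bound: the cuts around single vertices already exclude two orientations. If \<open>D - a\<close> is
  strongly connected, then at each end of \<open>a\<close> one of the other two arcs enters and the other one
  leaves. That every edge satisfies this in one of two orientations without sources and sinks is an
  unsatisfiable propositional formula in 30 variables.\<close>

section \<open>Strong digraphs\<close>

text \<open>Pairing \<open>xs\<close> with \<open>rotate1 xs\<close> lists the steps of a closed
  walk, including the one from the last entry back to the first. If no arc left \<open>X\<close>,
  the walk could never get out of \<open>X\<close> once inside, yet it visits vertices on both
  sides.\<close>

lemma strong_closed_walk:
  assumes "set xs = verts D" "set (zip xs (rotate1 xs)) \<subseteq> arcs_ends D"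
  shows "strong D"
  unfolding strong_def
proof (intro allI impI, rule ccontr)
  fix X assume X: "X \<noteq> {}" "X \<subset> verts D"
    and no: "\<not> (\<exists>a\<in>arcs D. tail D a \<in> X \<and> head D a \<in> verts D - X)"
  let ?n = "length xs"
  obtain x y where "x \<in> X" "x \<in> set xs" "y \<notin> X" "y \<in> set xs"
    using X assms(1) by blast
  then obtain i j where i: "i < ?n" "xs ! i \<in> X" and j: "j < ?n" "xs ! j \<notin> X"
    by (auto simp: in_set_conv_nth)
  have "xs ! ((i + k) mod ?n) \<in> X" for k
  proof (induction k)
    case 0
    then show ?case using i by simp
  next
    case (Suc k)
    let ?m = "(i + k) mod ?n"
    have m: "?m < ?n" using i by (intro mod_less_divisor) auto
    then have "(xs ! ?m, rotate1 xs ! ?m) \<in> set (zip xs (rotate1 xs))"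
      by (force simp: in_set_zip)
    moreover have "rotate1 xs ! ?m = xs ! ((i + Suc k) mod ?n)"
      using m by (simp add: nth_rotate1 mod_Suc_eq)
    ultimately have "(xs ! ?m, xs ! ((i + Suc k) mod ?n)) \<in> arcs_ends D"
      using assms(2) by auto
    moreover have "xs ! ((i + Suc k) mod ?n) \<in> verts D"
      unfolding assms(1)[symmetric] using i by (intro nth_mem mod_less_divisor) auto
    ultimately show ?case using no Suc.IH by (auto simp: arcs_ends_conv)
  qed
  \<comment> \<open>Starting from position \<open>i\<close>, this many steps lead to
    \<open>?n + j\<close>, which is position \<open>j\<close> modulo \<open>?n\<close>.\<close>
  from this[of "?n - i + j"] show False using i j by simp
qed

lemma strong_leaving_arc:
  assumes "strong D" "w \<in> verts D" "verts D \<noteq> {w}"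
  shows "\<exists>a\<in>arcs D. tail D a = w \<and> head D a \<noteq> w"
proof -
  have "{w} \<subset> verts D" using assms by auto
  then obtain a where "a \<in> arcs D" "tail D a \<in> {w}" "head D a \<in> verts D - {w}"
    using assms(1) unfolding strong_def by (meson insert_not_empty)
  then show ?thesis by auto
qed

text \<open>The cut is taken at the complement of \<open>w\<close>: an arc leaving it has head
  \<open>w\<close>.\<close>

lemma strong_entering_arc:
  assumes "strong D" "w \<in> verts D" "verts D \<noteq> {w}"
  shows "\<exists>a\<in>arcs D. tail D a \<noteq> w \<and> head D a = w"
proof -
  have "verts D - {w} \<noteq> {}" "verts D - {w} \<subset> verts D" using assms by auto
  then obtain a where "a \<in> arcs D" "tail D a \<in> verts D - {w}" "head D a \<in> verts D - (verts D - {w})"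
    using assms(1) unfolding strong_def by meson
  then show ?thesis by auto
qed

lemma strong_if_strong_del_arc:
  assumes "strong (pre_digraph.del_arc D e)"
  shows "strong D"
  unfolding strong_def
proof (intro allI impI)
  fix X assume "X \<noteq> {}" "X \<subset> verts D"
  with assms have "\<exists>a\<in>arcs D - {e}. tail D a \<in> X \<and> head D a \<in> verts D - X"
    unfolding strong_def pre_digraph.del_arc_simps by simp
  then show "\<exists>a\<in>arcs D. tail D a \<in> X \<and> head D a \<in> verts D - X" by auto
qed

text \<open>The pair \<open>D 1\<close>, \<open>D k\<close> treats one and two orientations alike. A
  digraph that is not strong stays so after deleting an arc, so if one of the two is not strong, the
  other serves every edge and is taken as both \<open>A\<close> and \<open>B\<close>. Strength of
  both is what later rules out sources and sinks.\<close>

lemma frank_orientations_le_two: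
  assumes "frank_orientations G k D" "k \<le> 2" "uedges G \<noteq> {}"
  obtains A B where "orientation_of A G" "orientation_of B G" "strong A" "strong B"
    "\<And>e. e \<in> uedges G \<Longrightarrow> strong (pre_digraph.del_arc A e) \<or> strong (pre_digraph.del_arc B e)"
proof -
  have k: "1 \<le> k" using assms(1,3) unfolding frank_orientations_def by (cases k) auto
  have cover: "strong (pre_digraph.del_arc (D 1) e) \<or> strong (pre_digraph.del_arc (D k) e)"
    if e: "e \<in> uedges G" for e
  proof -
    obtain i where i: "i \<in> {1..k}" "strong (pre_digraph.del_arc (D i) e)"
      using assms(1) e unfolding frank_orientations_def by blast
    with assms(2) have "i = 1 \<or> i = k" by auto
    with i show ?thesis by auto
  qed
  have o: "orientation_of (D 1) G" "orientation_of (D k) G"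
    using assms(1) k unfolding frank_orientations_def by simp_all
  have del: "strong (D i)" if "strong (pre_digraph.del_arc (D i) e)" for i e
    using that by (rule strong_if_strong_del_arc)
  show thesis
  proof (cases "strong (D 1)")
    case 1: True
    show thesis
    proof (cases "strong (D k)")
      case True
      then show thesis using that[OF o 1] cover by simp
    next
      case False
      then have "strong (pre_digraph.del_arc (D 1) e)" if "e \<in> uedges G" for e
        using cover[OF that] del by auto
      then show thesis using that[OF o(1,1) 1 1] by simp
    qed
  next
    case False
    then have *: "strong (pre_digraph.del_arc (D k) e)" if "e \<in> uedges G" for e
      using cover[OF that] del by auto
    with assms(3) have "strong (D k)" using del by auto
    then show thesis using that[OF o(2,2)] * by simp
  qed
qed

section \<open>The lower bound\<close>

definition petersen_nbs :: "nat \<Rightarrow> nat set" where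
  "petersen_nbs w = {x. {w, x} \<in> uedges petersen}"

lemma petersen_nbs:
  "petersen_nbs 0 = {1, 4, 5}" "petersen_nbs 1 = {0, 2, 6}" "petersen_nbs 2 = {1, 3, 7}"
  "petersen_nbs 3 = {2, 4, 8}" "petersen_nbs 4 = {0, 3, 9}" "petersen_nbs 5 = {0, 7, 8}"
  "petersen_nbs 6 = {1, 8, 9}" "petersen_nbs 7 = {2, 5, 9}" "petersen_nbs 8 = {3, 5, 6}"
  "petersen_nbs 9 = {4, 6, 7}"
  unfolding petersen_nbs_def uedges_petersen petersen_pairs_def
  by (auto simp: doubleton_eq_iff)

text \<open>Here \<open>q w x\<close> stands for an arc from \<open>w\<close> to \<open>x\<close>.\<close>

definition passes :: "(nat \<Rightarrow> nat \<Rightarrow> bool) \<Rightarrow> nat \<Rightarrow> nat set \<Rightarrow> bool" where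
  "passes q w S \<longleftrightarrow> (\<exists>x\<in>S. q w x) \<and> (\<exists>x\<in>S. \<not> q w x)"

text \<open>The 30 variables are \<open>p u v\<close> and \<open>q u v\<close> for the 15 listed
  pairs; the first two hypotheses express the reversed pairs through them.\<close>

lemma petersen_no_two_orientations:
  fixes p q :: "nat \<Rightarrow> nat \<Rightarrow> bool"
  assumes "\<forall>(u, v)\<in>set petersen_pairs. p v u \<longleftrightarrow> \<not> p u v"
    and "\<forall>(u, v)\<in>set petersen_pairs. q v u \<longleftrightarrow> \<not> q u v"
    and "\<forall>w\<in>{0, 1, 2, 3, 4, 5, 6, 7, 8, 9}. passes p w (petersen_nbs w)"
    and "\<forall>w\<in>{0, 1, 2, 3, 4, 5, 6, 7, 8, 9}. passes q w (petersen_nbs w)"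
    and "\<forall>(u, v)\<in>set petersen_pairs.
      passes p u (petersen_nbs u - {v}) \<and> passes p v (petersen_nbs v - {u}) \<or>
      passes q u (petersen_nbs u - {v}) \<and> passes q v (petersen_nbs v - {u})"
  shows False
  using assms
  \<comment> \<open>Without \<open>One_nat_def\<close> the vertex \<open>1\<close> keeps the form in
    which the equations \<open>petersen_nbs\<close> mention it.\<close>
  by (simp add: petersen_pairs_def petersen_nbs passes_def insert_Diff_if del: One_nat_def) sat

text \<open>For an orientation the tail alone fixes the direction of an edge; the value is
  meaningful only if \<open>{u, v}\<close> is an edge.\<close>

definition arc_dir :: "(nat, nat set) pre_digraph \<Rightarrow> nat \<Rightarrow> nat \<Rightarrow> bool" where
  "arc_dir D u v \<longleftrightarrow> tail D {u, v} = u"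

lemma petersen_simps [simp]:
  "uverts petersen = {..<10}" "uends petersen = (\<lambda>e. e)"
  by (simp_all add: petersen_def)

lemma petersen_edge_neq: "{u, v} \<in> uedges petersen \<Longrightarrow> u \<noteq> v"
  by (auto simp: uedges_petersen petersen_pairs_def doubleton_eq_iff)

lemma arc_dir_commute:
  assumes "orientation_of D petersen" "{u, v} \<in> uedges petersen"
  shows "arc_dir D v u \<longleftrightarrow> \<not> arc_dir D u v"
proof -
  have "tail D {u, v} \<in> {u, v}" using assms by (auto simp: orientation_of_def doubleton_eq_iff)
  then show ?thesis
    using petersen_edge_neq[OF assms(2)] by (auto simp: arc_dir_def insert_commute)
qed

text \<open>The far ends of an arc of \<open>H\<close> leaving \<open>w\<close> and of one entering
  \<open>w\<close> are the two required neighbours. A general \<open>F\<close> covers both the whole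
  orientation and the deletion of one arc.\<close>

lemma passes_if_strong:
  assumes D: "orientation_of D petersen" and w: "w < 10"
    and H: "strong H" "verts H = verts D" "arcs H = arcs D - F" "tail H = tail D" "head H = head D"
  shows "passes (arc_dir D) w {x \<in> petersen_nbs w. {w, x} \<notin> F}"
proof -
  have V: "w \<in> verts H" "verts H \<noteq> {w}"
  proof -
    have V: "verts H = {..<10}" using D H by (simp add: orientation_of_def)
    show "w \<in> verts H" unfolding V using w by simp
    show "verts H \<noteq> {w}"
    proof
      assume "verts H = {w}"
      moreover have "0 \<in> verts H" "1 \<in> verts H" unfolding V by simp_all
      ultimately show False by simp
    qed
  qed
  have ends: "{tail D a, head D a} = a" if "a \<in> arcs H" for a
    using that D H by (auto simp: orientation_of_def)
  have mem: "a \<in> uedges petersen" "a \<notin> F" if "a \<in> arcs H" for a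
    using that D H by (auto simp: orientation_of_def)
  obtain a where a: "a \<in> arcs H" "tail D a = w"
    using strong_leaving_arc[OF H(1) V] H by auto
  have aw: "{w, head D a} = a" using ends[OF a(1)] a by simp
  obtain b where b: "b \<in> arcs H" "tail D b \<noteq> w" "head D b = w"
    using strong_entering_arc[OF H(1) V] H by auto
  have bw: "{w, tail D b} = b" using ends[OF b(1)] b by (simp add: insert_commute)
  show ?thesis
    unfolding passes_def
  proof
    show "\<exists>x\<in>{x \<in> petersen_nbs w. {w, x} \<notin> F}. arc_dir D w x"
      using a mem[OF a(1)] aw by (intro bexI[of _ "head D a"]) (auto simp: arc_dir_def petersen_nbs_def)
    show "\<exists>x\<in>{x \<in> petersen_nbs w. {w, x} \<notin> F}. \<not> arc_dir D w x"
      using b mem[OF b(1)] bw by (intro bexI[of _ "tail D b"]) (auto simp: arc_dir_def petersen_nbs_def)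
  qed
qed

lemma strong_passes:
  assumes "orientation_of D petersen" "strong D" "w < 10"
  shows "passes (arc_dir D) w (petersen_nbs w)"
  using passes_if_strong[OF assms(1,3,2), of "{}"] by simp

lemma strong_del_arc_passes:
  assumes "orientation_of D petersen" "strong (pre_digraph.del_arc D {u, v})" "u < 10"
  shows "passes (arc_dir D) u (petersen_nbs u - {v})"
proof -
  have "{x \<in> petersen_nbs u. {u, x} \<notin> {{u, v}}} = petersen_nbs u - {v}"
    by (auto simp: doubleton_eq_iff)
  then show ?thesis
    using passes_if_strong[OF assms(1,3,2), of "{{u, v}}"]
    by (simp add: pre_digraph.del_arc_simps)
qed

lemma petersen_frank_orientations_ge:
  assumes "frank_orientations petersen k D"
  shows "3 \<le> k"
proof (rule ccontr)
  assume "\<not> 3 \<le> k"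
  moreover have "uedges petersen \<noteq> {}" by (simp add: uedges_petersen petersen_pairs_def)
  ultimately obtain A B where AB: "orientation_of A petersen" "orientation_of B petersen"
    "strong A" "strong B"
    and cover: "\<And>e. e \<in> uedges petersen \<Longrightarrow>
      strong (pre_digraph.del_arc A e) \<or> strong (pre_digraph.del_arc B e)"
    using frank_orientations_le_two[OF assms] by auto
  have pairs: "{u, v} \<in> uedges petersen" "u < 10" "v < 10" if "(u, v) \<in> set petersen_pairs" for u v
    using that by (force simp: uedges_petersen) (use that in \<open>auto simp: petersen_pairs_def\<close>)
  have ok: "passes (arc_dir A) u (petersen_nbs u - {v}) \<and> passes (arc_dir A) v (petersen_nbs v - {u}) \<or>
      passes (arc_dir B) u (petersen_nbs u - {v}) \<and> passes (arc_dir B) v (petersen_nbs v - {u})"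
    if "(u, v) \<in> set petersen_pairs" for u v
    \<comment> \<open>The condition at the second end \<open>v\<close> comes from the same lemma
      with the edge written as \<open>{v, u}\<close>.\<close>
    using cover[OF pairs(1)[OF that]] pairs(2,3)[OF that]
      strong_del_arc_passes[OF AB(1), of u v] strong_del_arc_passes[OF AB(1), of v u]
      strong_del_arc_passes[OF AB(2), of u v] strong_del_arc_passes[OF AB(2), of v u]
    unfolding insert_commute[of v u] by blast
  show False
    by (rule petersen_no_two_orientations[of "arc_dir A" "arc_dir B"])
      (use AB pairs(1) ok in \<open>auto simp: arc_dir_commute strong_passes\<close>)
qed

section \<open>The upper bound\<close>

abbreviation unordered :: "nat \<times> nat \<Rightarrow> nat set" where
  "unordered \<equiv> \<lambda>(u, v). {u, v}"

text \<open>Arcs keep their edge names, so the ordered pair in \<open>L\<close> is recovered by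
  inverting \<open>unordered\<close>; this is sound when \<open>unordered\<close> is injective on
  \<open>L\<close>.\<close>

definition orient :: "(nat \<times> nat) list \<Rightarrow> (nat, nat set) pre_digraph" where
  "orient L = \<lparr>verts = {..<10}, arcs = uedges petersen,
     tail = (\<lambda>e. fst (the_inv_into (set L) unordered e)),
     head = (\<lambda>e. snd (the_inv_into (set L) unordered e))\<rparr>"

text \<open>Comparing entry by entry, each pair kept or flipped, makes this checkable by
  simplification; injectivity and the image then transfer from
  \<open>petersen_pairs\<close>.\<close>

definition orients_petersen :: "(nat \<times> nat) list \<Rightarrow> bool" where
  "orients_petersen L \<longleftrightarrow> map unordered L = map unordered petersen_pairs"

lemma orients_petersenD:
  assumes "orients_petersen L"
  shows "inj_on unordered (set L)" "unordered ` set L = uedges petersen"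
proof -
  have L: "map unordered L = map unordered petersen_pairs"
    using assms by (simp add: orients_petersen_def)
  have "distinct (map unordered petersen_pairs)"
    by (simp add: petersen_pairs_def doubleton_eq_iff)
  then show "inj_on unordered (set L)"
    unfolding L[symmetric] by (simp add: distinct_map)
  show "unordered ` set L = uedges petersen"
    using arg_cong[OF L, of set] by (simp add: uedges_petersen)
qed

lemma orientation_of_orient:
  assumes "orients_petersen L"
  shows "orientation_of (orient L) petersen"
  unfolding orientation_of_def
proof (intro conjI ballI)
  fix e assume "e \<in> uedges petersen"
  then have "unordered (the_inv_into (set L) unordered e) = e"
    using orients_petersenD[OF assms] by (intro f_the_inv_into_f) auto
  then show "{tail (orient L) e, head (orient L) e} = uends petersen e"
    by (simp add: orient_def case_prod_beta)
qed (simp_all add: orient_def)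

text \<open>One closed walk avoiding all of \<open>E\<close> certifies the deletion of each single
  edge of \<open>E\<close>. The premises on \<open>xs\<close> are phrased so that simplification
  evaluates them on concrete lists.\<close>

lemma strong_del_arc_orient:
  assumes L: "orients_petersen L" and e: "e \<in> E"
    and xs: "set [0..<10] \<subseteq> set xs" "set xs \<subseteq> {..<10}"
    and walk: "\<forall>a\<in>set (zip xs (rotate1 xs)). a \<in> set L \<and> unordered a \<notin> E"
  shows "strong (pre_digraph.del_arc (orient L) e)"
proof (rule strong_closed_walk[of xs])
  have "set xs = {..<10}" using xs unfolding atLeast_upt by (intro equalityI) simp_all
  then show "set xs = verts (pre_digraph.del_arc (orient L) e)"
    by (simp add: pre_digraph.del_arc_simps orient_def)
  show "set (zip xs (rotate1 xs)) \<subseteq> arcs_ends (pre_digraph.del_arc (orient L) e)"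
  proof
    fix a assume a: "a \<in> set (zip xs (rotate1 xs))"
    then have "a \<in> set L" "unordered a \<noteq> e" using walk e by blast+
    moreover from this have "the_inv_into (set L) unordered (unordered a) = a"
      "unordered a \<in> uedges petersen"
      using orients_petersenD[OF L] by (simp add: the_inv_into_f_f, blast)
    ultimately show "a \<in> arcs_ends (pre_digraph.del_arc (orient L) e)"
      by (force simp: arcs_ends_conv pre_digraph.del_arc_simps orient_def)
  qed
qed

text \<open>In all three lists the inner pentagram is the directed cycle 5, 7, 9, 6, 8. The outer
  cycle is directed here, while \<open>arcs2\<close> reverses its edge 12 and \<open>arcs3\<close>
  its edge 23; the spokes vary.\<close>

definition arcs1 :: "(nat \<times> nat) list" where
  "arcs1 = [(0,1),(1,2),(2,3),(3,4),(4,0),(5,0),(6,1),(2,7),(3,8),(4,9),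
    (5,7),(6,8),(7,9),(8,5),(9,6)]"

definition arcs2 :: "(nat \<times> nat) list" where
  "arcs2 = [(0,1),(2,1),(2,3),(3,4),(4,0),(0,5),(1,6),(7,2),(8,3),(4,9),
    (5,7),(6,8),(7,9),(8,5),(9,6)]"

definition arcs3 :: "(nat \<times> nat) list" where
  "arcs3 = [(0,1),(1,2),(3,2),(3,4),(4,0),(5,0),(1,6),(2,7),(8,3),(9,4),
    (5,7),(6,8),(7,9),(8,5),(9,6)]"

lemma orients_petersen_arcs:
  "orients_petersen arcs1" "orients_petersen arcs2" "orients_petersen arcs3"
  unfolding orients_petersen_def petersen_pairs_def arcs1_def arcs2_def arcs3_def
  by (simp_all add: doubleton_eq_iff)

text \<open>The edges missed by a spanning closed walk form a matching, since each vertex keeps an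
  arc in and an arc out. A perfect matching would leave a Hamiltonian cycle, which the Petersen
  graph lacks, so four missed edges are the most possible. Each walk attains this, and the four sets
  cover the 15 edges with only \<open>{2,7}\<close> repeated.\<close>

lemma strong_del_arc_arcs:
  "e \<in> {{0,4}, {1,6}, {2,7}, {3,8}} \<union> {{0,5}, {2,7}, {4,9}, {6,8}} \<Longrightarrow>
    strong (pre_digraph.del_arc (orient arcs1) e)"
  "e \<in> {{0,1}, {2,3}, {7,9}, {5,8}} \<Longrightarrow> strong (pre_digraph.del_arc (orient arcs2) e)"
  "e \<in> {{1,2}, {3,4}, {5,7}, {6,9}} \<Longrightarrow> strong (pre_digraph.del_arc (orient arcs3) e)"
proof -
  note walk = orients_petersen_arcs[THEN strong_del_arc_orient]
  \<comment> \<open>The first orientation gets two walks, one for each set of the union.\<close>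
  have "strong (pre_digraph.del_arc (orient arcs1) e)" if "e \<in> {{0,4}, {1,6}, {2,7}, {3,8}}"
    by (rule walk(1)[OF that, of "[0,1,2,3,4,9,6,8,5,7,9,6,8,5]"])
      (simp_all add: arcs1_def upt_rec doubleton_eq_iff)
  moreover have "strong (pre_digraph.del_arc (orient arcs1) e)" if "e \<in> {{0,5}, {2,7}, {4,9}, {6,8}}"
    by (rule walk(1)[OF that, of "[0,1,2,3,8,5,7,9,6,1,2,3,4]"])
      (simp_all add: arcs1_def upt_rec doubleton_eq_iff)
  ultimately show "strong (pre_digraph.del_arc (orient arcs1) e)"
    if "e \<in> {{0,4}, {1,6}, {2,7}, {3,8}} \<union> {{0,5}, {2,7}, {4,9}, {6,8}}"
    using that by (elim UnE)
  show "strong (pre_digraph.del_arc (orient arcs2) e)" if "e \<in> {{0,1}, {2,3}, {7,9}, {5,8}}"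
    by (rule walk(2)[OF that, of "[0,5,7,2,1,6,8,3,4,9,6,8,3,4]"])
      (simp_all add: arcs2_def upt_rec doubleton_eq_iff)
  show "strong (pre_digraph.del_arc (orient arcs3) e)" if "e \<in> {{1,2}, {3,4}, {5,7}, {6,9}}"
    by (rule walk(3)[OF that, of "[0,1,6,8,3,2,7,9,4,0,1,6,8,5]"])
      (simp_all add: arcs3_def upt_rec doubleton_eq_iff)
qed

lemma petersen_frank_orientations_three:
  "frank_orientations petersen 3 (\<lambda>i. orient (if i = 1 then arcs1 else if i = 2 then arcs2 else arcs3))"
  (is "frank_orientations _ _ ?D")
  unfolding frank_orientations_def
proof (intro conjI ballI)
  show "orientation_of (?D i) petersen" for i
    using orients_petersen_arcs by (simp add: orientation_of_orient)
  fix e assume "e \<in> uedges petersen"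
  then have "e \<in> {{0,4}, {1,6}, {2,7}, {3,8}} \<union> {{0,5}, {2,7}, {4,9}, {6,8}} \<or>
      e \<in> {{0,1}, {2,3}, {7,9}, {5,8}} \<or> e \<in> {{1,2}, {3,4}, {5,7}, {6,9}}"
    unfolding uedges_petersen petersen_pairs_def
    by simp (elim disjE; simp add: doubleton_eq_iff)
  then have "strong (pre_digraph.del_arc (?D 1) e) \<or> strong (pre_digraph.del_arc (?D 2) e) \<or>
      strong (pre_digraph.del_arc (?D 3) e)"
    \<comment> \<open>Membership must stay unexpanded to match the premises of
      \<open>strong_del_arc_arcs\<close>.\<close>
    by (elim disjE) (simp_all del: insert_iff Un_iff add: strong_del_arc_arcs)
  then show "\<exists>i\<in>{1..3}. strong (pre_digraph.del_arc (?D i) e)"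
    by (elim disjE) (rule bexI, assumption, simp)+
qed

theorem theorem6:
  shows "frank_number petersen = 3"
  unfolding frank_number_def
proof (rule Least_equality)
  show "\<exists>D. frank_orientations petersen 3 D"
    by (rule exI[of "frank_orientations petersen 3", OF petersen_frank_orientations_three])
  show "3 \<le> k" if "\<exists>D. frank_orientations petersen k D" for k
    using that petersen_frank_orientations_ge by (elim exE)
qed

end
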